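(* For every integer $d \ge 2$ one has $L(2,d) \ge 5$, where $L(n,d)$ denotes the smallest natural number $L$ such that for every normal topological space $T$ of dimension $d$, every nullhomotopic continuous map $f \colon T \to SL_n(\mathbb{C})$ can be written as a product of no more than $L$ unitriangular matrices with entries in $\mathcal{C}(T)$.
   Context: $\mathcal{C}(T)$ is the ring of complex-valued continuous functions on the topological space $T$, and a continuous map $T \to SL_n(\mathbb{C})$ is identified with an element of $SL_n(\mathcal{C}(T))$. A unitriangular matrix over a ring $R$ is an upper or lower triangular matrix with entries in $R$ and all diagonal entries equal to $1$. A continuous map $f \colon T \to SL_n(\mathbb{C})$ is nullhomotopic if there is a continuous map $h \colon [0,1] \times T \to SL_n(\mathbb{C})$ with $h(0,x) = I$ and $h(1,x) = f(x)$ for all $x \in T$. The dimension of $T$ is its covering dimension. By a theorem of Vaserstein, for any natural number $n$ and integer $d \ge 0$ a finite number $L$ with the stated property exists, so $L(n,d)$ is well defined. *)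

theory Defs
  imports "HOL-Analysis.Analysis"
begin

section \<open>Covering dimension\<close>

text \<open>
  Covering dimension in the sense of finite open covers, the usual notion for normal spaces.
  \<open>covering_dim_less X k\<close> says that the dimension of \<open>X\<close> is at most \<open>k - 1\<close>: every finite open
  cover has a finite open refinement in which no point lies in more than \<open>k\<close> members.  The shift
  by one avoids the value \<open>-1\<close> of the empty space, which is the only space with
  \<open>covering_dim_less X 0\<close>.
\<close>

definition finite_open_cover :: "'a topology \<Rightarrow> 'a set set \<Rightarrow> bool" where
  "finite_open_cover X \<U> \<longleftrightarrow> finite \<U> \<and> (\<forall>U\<in>\<U>. openin X U) \<and> \<Union>\<U> = topspace X"

definition covering_dim_less :: "'a topology \<Rightarrow> nat \<Rightarrow> bool" where
  "covering_dim_less X k \<longleftrightarrow>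
     (\<forall>\<U>. finite_open_cover X \<U> \<longrightarrow>
        (\<exists>\<V>. finite_open_cover X \<V> \<and> (\<forall>V\<in>\<V>. \<exists>U\<in>\<U>. V \<subseteq> U) \<and>
             (\<forall>x\<in>topspace X. card {V \<in> \<V>. x \<in> V} \<le> k)))"

definition has_covering_dim :: "'a topology \<Rightarrow> nat \<Rightarrow> bool" where
  "has_covering_dim X d \<longleftrightarrow> covering_dim_less X (Suc d) \<and> \<not> covering_dim_less X d"


section \<open>Maps into the special linear group\<close>

text \<open>
  The size \<open>n\<close> of the matrices is the cardinality of the index type \<open>'n\<close>; its linear order is
  what makes a matrix upper or lower triangular.
\<close>

type_synonym 'n cmat = "((complex, 'n) vec, 'n) vec"

definition SL_top :: "('n::finite) cmat topology" where
  "SL_top = top_of_set {A. det A = 1}"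

text \<open>Maps are functions on the whole type, of which only the values on \<open>topspace X\<close> matter.\<close>

definition nullhomotopic_SL :: "'a topology \<Rightarrow> ('a \<Rightarrow> ('n::finite) cmat) \<Rightarrow> bool" where
  "nullhomotopic_SL X f \<longleftrightarrow>
     (\<exists>h. continuous_map (prod_topology (top_of_set {0..1::real}) X) SL_top h \<and>
          (\<forall>x\<in>topspace X. h (0, x) = mat 1 \<and> h (1, x) = f x))"

definition upper_unitriangular :: "('n::{finite,linorder}) cmat \<Rightarrow> bool" where
  "upper_unitriangular A \<longleftrightarrow> (\<forall>i. A $ i $ i = 1) \<and> (\<forall>i j. j < i \<longrightarrow> A $ i $ j = 0)"

definition lower_unitriangular :: "('n::{finite,linorder}) cmat \<Rightarrow> bool" where
  "lower_unitriangular A \<longleftrightarrow> (\<forall>i. A $ i $ i = 1) \<and> (\<forall>i j. i < j \<longrightarrow> A $ i $ j = 0)"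

text \<open>
  A matrix over the ring of continuous functions on \<open>X\<close> is represented by the corresponding
  matrix-valued map; whether it is upper or lower triangular does not depend on the point.
\<close>

definition unitriangular_over_C ::
    "'a topology \<Rightarrow> ('a \<Rightarrow> ('n::{finite,linorder}) cmat) \<Rightarrow> bool" where
  "unitriangular_over_C X M \<longleftrightarrow>
     (\<forall>i j. continuous_map X euclidean (\<lambda>x. M x $ i $ j)) \<and>
     ((\<forall>x\<in>topspace X. upper_unitriangular (M x)) \<or>
      (\<forall>x\<in>topspace X. lower_unitriangular (M x)))"

definition product_of_at_most ::
    "nat \<Rightarrow> 'a topology \<Rightarrow> ('a \<Rightarrow> ('n::{finite,linorder}) cmat) \<Rightarrow> bool" where
  "product_of_at_most L X f \<longleftrightarrow>
     (\<exists>Ms. length Ms \<le> L \<and> (\<forall>M\<in>set Ms. unitriangular_over_C X M) \<and>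
           (\<forall>x\<in>topspace X. f x = foldr (\<lambda>M A. M x ** A) Ms (mat 1)))"


section \<open>The number of unitriangular factors\<close>

definition suffices ::
    "'a itself \<Rightarrow> 'n::{finite,linorder} itself \<Rightarrow> nat \<Rightarrow> nat \<Rightarrow> bool" where
  "suffices _ _ d L \<longleftrightarrow>
     (\<forall>(X::'a topology) (f::'a \<Rightarrow> 'n cmat).
        normal_space X \<longrightarrow> has_covering_dim X d \<longrightarrow> nullhomotopic_SL X f \<longrightarrow>
        product_of_at_most L X f)"

text \<open>
  \<open>unitri_number TYPE('a) TYPE('n) d\<close> is \<open>L(n,d)\<close> with \<open>n = CARD('n)\<close>, for spaces whose points are
  taken from the type \<open>'a\<close>; a single formula cannot quantify over the spaces on all types.  Enlarging
  \<open>'a\<close> can only increase it.  The infimum of a nonempty set of natural numbers in \<^typ>\<open>enat\<close>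
  is its least element; if no natural number had the property, the value would be \<open>\<infinity>\<close>.
\<close>

definition unitri_number :: "'a itself \<Rightarrow> 'n::{finite,linorder} itself \<Rightarrow> nat \<Rightarrow> enat" where
  "unitri_number A N d = Inf {enat L |L. suffices A N d L}"

end

theory Submission
  imports Defs
begin

text \<open>
  On the unit disc consider a map to \<open>SL\<^sub>2\<close> with second column \<open>(z, \<bar>z\<bar>\<^sup>2 - 1)\<close>.  In a factorization into
  four alternating elementary matrices with off-diagonal entries \<open>p1, p2, p3, p4\<close>, a diagonal entry of
  the product is \<open>1 + p2 * p3\<close>.  The diagonal entries are nonpositive real numbers here, so \<open>p3\<close> has
  no zero on the disc; on the circle they vanish, which makes \<open>p3\<close> equal to an off-diagonal entry, of
  winding number \<open>1\<close> or \<open>- 1\<close>.  This is impossible.  The map extends to the plane and pulls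
  back to any space with a map to the plane that has a section over the disc, such as the
  \<open>d\<close>-dimensional cube.
\<close>

subsection \<open>Alternating products of elementary matrices\<close>

definition flip2 :: "2 \<Rightarrow> 2" where
  "flip2 k = (if k = 1 then 2 else 1)"

lemma flip2_simps [simp]: "flip2 1 = 2" "flip2 2 = 1" "flip2 (flip2 k) = k"
  using exhaust_2[of k] by (auto simp: flip2_def)

lemma eq_flip2_iff: "l \<noteq> k \<longleftrightarrow> l = flip2 k"
  using exhaust_2[of k] exhaust_2[of l] by (auto simp: flip2_def)

text \<open>\<open>k\<close> is the row of the off-diagonal entry. Naming the factor by its row, not
  by upper or lower, lets one computation serve both alternating patterns.\<close>

definition elem2 :: "2 \<Rightarrow> complex \<Rightarrow> 2 cmat" where
  "elem2 k z = (\<chi> i j. if i = j then 1 else if i = k then z else 0)"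

fun altprod :: "2 \<Rightarrow> complex list \<Rightarrow> 2 cmat" where
  "altprod k [] = mat 1"
| "altprod k (z # zs) = elem2 k z ** altprod (flip2 k) zs"

lemma elem2_0: "elem2 k 0 = mat 1"
  by (simp add: elem2_def mat_def vec_eq_iff)

lemma elem2_add: "elem2 k w ** elem2 k z = elem2 k (w + z)"
  using exhaust_2[of k]
  by (auto simp: elem2_def vec_eq_iff forall_2 matrix_matrix_mult_def sum_2)

text \<open>A zero entry gives the identity matrix, so a shorter alternating product can be padded
  to exactly four factors.\<close>

lemma altprod_append_zeros: "altprod k (zs @ replicate n 0) = altprod k zs"
proof (induction zs arbitrary: k)
  case Nil
  show ?case by (induction n arbitrary: k) (auto simp: elem2_0)
qed auto

text \<open>The last factor only adds a multiple of column \<open>flip2 k\<close> to column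
  \<open>k\<close>. Hence column \<open>flip2 k\<close> comes from the first three factors: it
  starts with \<open>x3\<close> in row \<open>k\<close> and 1 in row \<open>flip2 k\<close>, and
  then undergoes the row operations by \<open>x2\<close> and \<open>x1\<close>.\<close>

lemma altprod_four_entries:
  assumes "A = altprod k [x1, x2, x3, x4]"
  shows "A $ flip2 k $ flip2 k = 1 + x2 * x3"
    and "A $ k $ flip2 k = x3 + x1 * A $ flip2 k $ flip2 k"
  using exhaust_2[of k] unfolding assms
  by (auto simp: elem2_def matrix_matrix_mult_def sum_2 mat_def algebra_simps)

section \<open>Reduction of unitriangular factorizations to alternating ones\<close>

lemma unitriangular_over_C_elem2:
  fixes M :: "'a \<Rightarrow> 2 cmat"
  assumes "unitriangular_over_C X M"
  obtains k g where "continuous_map X euclidean g" "\<And>x. x \<in> topspace X \<Longrightarrow> M x = elem2 k (g x)"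
proof -
  \<comment> \<open>\<open>l\<close> is the smaller index, whichever it is in the order of the type.
    Upper unitriangular matrices have their free entry in row \<open>l\<close>, lower ones in row
    \<open>flip2 l\<close>.\<close>
  obtain l :: 2 where lt: "\<forall>i j::2. j < i \<longleftrightarrow> j = l \<and> i = flip2 l"
  proof (cases "(1::2) < 2")
    case True
    then have "\<forall>i j::2. j < i \<longleftrightarrow> j = 1 \<and> i = flip2 1"
      unfolding forall_2 using less_asym[OF True] by simp
    then show thesis by (rule that)
  next
    case False
    then have "(2::2) < 1" by (simp add: less_le)
    then have "\<forall>i j::2. j < i \<longleftrightarrow> j = 2 \<and> i = flip2 2"
      unfolding forall_2 using False by simp
    then show thesis by (rule that)
  qed
  have "\<exists>k. \<forall>x\<in>topspace X. M x = elem2 k (M x $ k $ flip2 k)"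
  proof (cases "\<forall>x\<in>topspace X. upper_unitriangular (M x)")
    case True
    then show ?thesis
      using exhaust_2[of l]
      by (intro exI[of _ l]) (auto simp: upper_unitriangular_def elem2_def vec_eq_iff forall_2 lt)
  next
    case False
    then have "\<forall>x\<in>topspace X. lower_unitriangular (M x)"
      using assms unfolding unitriangular_over_C_def by argo
    then show ?thesis
      using exhaust_2[of l]
      by (intro exI[of _ "flip2 l"])
        (auto simp: lower_unitriangular_def elem2_def vec_eq_iff forall_2 lt)
  qed
  then obtain k where "\<forall>x\<in>topspace X. M x = elem2 k (M x $ k $ flip2 k)" ..
  moreover have "continuous_map X euclidean (\<lambda>x. M x $ k $ flip2 k)"
    using assms unfolding unitriangular_over_C_def by blast
  ultimately show thesis using that by blast
qed

text \<open>Neighbouring factors with the same row merge by adding their entries, so making the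
  product alternate never lengthens it.\<close>

lemma unitriangular_product_altprod:
  fixes Ms :: "('a \<Rightarrow> 2 cmat) list"
  assumes "\<forall>M\<in>set Ms. unitriangular_over_C X M"
  shows "\<exists>k gs. length gs \<le> length Ms \<and> (\<forall>g\<in>set gs. continuous_map X euclidean g) \<and>
    (\<forall>x\<in>topspace X. foldr (\<lambda>M A. M x ** A) Ms (mat 1) = altprod k (map (\<lambda>g. g x) gs))"
  using assms
proof (induction Ms)
  case Nil
  show ?case by (intro exI[of _ 1] exI[of _ "[]"]) auto
next
  case (Cons M Ms)
  then obtain k gs where gs: "length gs \<le> length Ms" "\<forall>g\<in>set gs. continuous_map X euclidean g"
    "\<And>x. x \<in> topspace X \<Longrightarrow>
       foldr (\<lambda>M A. M x ** A) Ms (mat 1) = altprod k (map (\<lambda>g. g x) gs)"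
    by auto
  obtain l h where h: "continuous_map X euclidean h" "\<And>x. x \<in> topspace X \<Longrightarrow> M x = elem2 l (h x)"
    using unitriangular_over_C_elem2[of X M] Cons.prems by (metis list.set_intros(1))
  consider "gs = []" | "l = flip2 k" | g gs' where "gs = g # gs'" "l = k"
    using eq_flip2_iff by (metis list.exhaust)
  then show ?case
  proof cases
    case 1
    then show ?thesis using gs h by (intro exI[of _ l] exI[of _ "[h]"]) auto
  next
    case 2
    then show ?thesis using gs h by (intro exI[of _ l] exI[of _ "h # gs"]) auto
  next
    case 3
    have "continuous_map X euclidean (\<lambda>x. h x + g x)"
      using 3 gs(2) h(1) by (intro continuous_map_add) auto
    then show ?thesis using gs h 3
      by (intro exI[of _ l] exI[of _ "(\<lambda>x. h x + g x) # gs'"])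
        (auto simp: matrix_mul_assoc elem2_add)
  qed
qed

lemma product_of_at_most_four_altprod:
  fixes f :: "'a \<Rightarrow> 2 cmat"
  assumes "product_of_at_most 4 X f"
  obtains k p1 p2 p3 p4 where
    "continuous_map X euclidean p1" "continuous_map X euclidean p2"
    "continuous_map X euclidean p3" "continuous_map X euclidean p4"
    "\<And>x. x \<in> topspace X \<Longrightarrow> f x = altprod k [p1 x, p2 x, p3 x, p4 x]"
proof -
  obtain Ms where Ms: "length Ms \<le> 4" "\<forall>M\<in>set Ms. unitriangular_over_C X M"
    "\<And>x. x \<in> topspace X \<Longrightarrow> f x = foldr (\<lambda>M A. M x ** A) Ms (mat 1)"
    using assms unfolding product_of_at_most_def by blast
  obtain k gs where gs: "length gs \<le> length Ms" "\<forall>g\<in>set gs. continuous_map X euclidean g"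
    "\<forall>x\<in>topspace X. foldr (\<lambda>M A. M x ** A) Ms (mat 1) = altprod k (map (\<lambda>g. g x) gs)"
    using unitriangular_product_altprod[OF Ms(2)] by blast
  define hs where "hs = gs @ replicate (4 - length gs) (\<lambda>_. 0)"
  have "length hs = 4" using gs(1) Ms(1) by (simp add: hs_def)
  then obtain p1 p2 p3 p4 where hs: "hs = [p1, p2, p3, p4]"
    by (auto simp: numeral_eq_Suc length_Suc_conv)
  have "\<forall>g\<in>set hs. continuous_map X euclidean g"
    using gs(2) by (auto simp: hs_def)
  moreover have "f x = altprod k (map (\<lambda>g. g x) hs)" if "x \<in> topspace X" for x
    using that gs(3) Ms(3) by (simp add: hs_def altprod_append_zeros)
  ultimately show thesis
    using that[of p1 p2 p3 p4 k] hs by simp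
qed

subsection \<open>A map that is not a product of four factors\<close>

text \<open>
  \<open>twist 1 z\<close> has second column \<open>(z, min 0 (\<bar>z\<bar>\<^sup>2 - 1))\<close>; the imaginary part \<open>t * (1 - t)\<close> keeps the
  second column away from zero along the homotopy from the identity.  The first column is chosen to
  make the determinant 1.
\<close>

definition twist_b :: "real \<Rightarrow> complex \<Rightarrow> complex" where
  "twist_b t z = of_real t * z"

definition twist_d :: "real \<Rightarrow> complex \<Rightarrow> complex" where
  "twist_d t z = Complex ((1 - t) + t * min 0 ((norm z)\<^sup>2 - 1)) (t * (1 - t))"

definition twist_n :: "real \<Rightarrow> complex \<Rightarrow> real" where
  "twist_n t z = (norm (twist_b t z))\<^sup>2 + (norm (twist_d t z))\<^sup>2"

definition twist :: "real \<Rightarrow> complex \<Rightarrow> 2 cmat" where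
  "twist t z = (\<chi> i j.
     if j = 2 then (if i = 1 then twist_b t z else twist_d t z)
     else (if i = 1 then cnj (twist_d t z) else - cnj (twist_b t z)) / of_real (twist_n t z))"

text \<open>If both entries vanish, the imaginary part forces \<open>t\<close> to be 0 or 1. At 0
  the lower entry is 1; at 1 the upper entry forces \<open>z = 0\<close>, where the lower entry is
  -1.\<close>

lemma twist_n_pos: "twist_n t z > 0"
proof -
  have "twist_b t z \<noteq> 0 \<or> twist_d t z \<noteq> 0"
  proof (rule ccontr)
    assume "\<not> ?thesis"
    then have b: "t = 0 \<or> z = 0" and d: "(1 - t) + t * min 0 ((norm z)\<^sup>2 - 1) = 0" "t * (1 - t) = 0"
      by (auto simp: twist_b_def twist_d_def complex_eq_iff)
    from d(2) have "t = 0 \<or> t = 1" by auto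
    then show False using b d(1) by auto
  qed
  then show ?thesis
    unfolding twist_n_def by (auto intro: add_pos_nonneg add_nonneg_pos)
qed

lemma det_twist: "det (twist t z) = 1"
proof -
  have "cnj (twist_d t z) * twist_d t z + twist_b t z * cnj (twist_b t z) = of_real (twist_n t z)"
    unfolding twist_n_def of_real_add complex_norm_square by (simp add: mult.commute)
  moreover have "of_real (twist_n t z) \<noteq> (0::complex)"
    using twist_n_pos[of t z] by simp
  ultimately show ?thesis
    by (simp add: det_2 twist_def divide_simps)
qed

lemma continuous_on_twist: "continuous_on UNIV (\<lambda>(t, z). twist t z)"
proof -
  have b: "continuous_on UNIV (\<lambda>p. twist_b (fst p) (snd p))"
    unfolding twist_b_def by (intro continuous_intros)
  have d: "continuous_on UNIV (\<lambda>p. twist_d (fst p) (snd p))"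
    unfolding twist_d_def Complex_eq by (intro continuous_intros)
  have n: "continuous_on UNIV (\<lambda>p. complex_of_real (twist_n (fst p) (snd p)))"
    unfolding twist_n_def by (intro continuous_intros b d)
  have nz: "complex_of_real (twist_n (fst p) (snd p)) \<noteq> 0" for p
    using twist_n_pos[of "fst p" "snd p"] by simp
  have "continuous_on UNIV (\<lambda>p. twist (fst p) (snd p) $ i $ j)" for i j
    unfolding twist_def
    using exhaust_2[of i] exhaust_2[of j] nz
    by (auto intro!: continuous_intros b d n)
  then have "continuous_on UNIV (\<lambda>p. \<chi> i. \<chi> j. twist (fst p) (snd p) $ i $ j)"
    by (intro continuous_on_vec_lambda) auto
  then show ?thesis
    by (simp add: case_prod_unfold)
qed

lemma nullhomotopic_twist:
  assumes "continuous_map X euclidean \<phi>"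
  shows "nullhomotopic_SL X (\<lambda>x. twist 1 (\<phi> x))"
proof -
  define h where "h = (\<lambda>(t, x). twist t (\<phi> x))"
  have "continuous_map (prod_topology (top_of_set {0..1::real}) X) euclidean (\<lambda>p. (fst p, \<phi> (snd p)))"
    unfolding prod_topology_euclidean[symmetric]
    by (intro continuous_map_pairedI continuous_map_into_fulltopology[OF continuous_map_fst]
        continuous_map_compose[OF continuous_map_snd assms, unfolded o_def])
  then have "continuous_map (prod_topology (top_of_set {0..1::real}) X) euclidean h"
    using continuous_map_compose[of _ euclidean _ euclidean "\<lambda>(t, z). twist t z"] continuous_on_twist
    by (fastforce simp: h_def o_def case_prod_unfold)
  then have "continuous_map (prod_topology (top_of_set {0..1}) X) SL_top h"
    by (auto simp: SL_top_def continuous_map_in_subtopology h_def det_twist)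
  moreover have "twist 0 z = mat 1" for z
    by (simp add: twist_def twist_n_def twist_b_def twist_d_def vec_eq_iff forall_2 mat_def
        complex_eq_iff cmod_power2)
  ultimately show ?thesis
    unfolding nullhomotopic_SL_def by (intro exI[of _ h]) (auto simp: h_def)
qed

text \<open>
  In an alternating factorization, the third factor \<open>p3\<close> vanishes only where the diagonal entry
  \<open>1 + p2 * p3\<close> equals 1, hence nowhere on the disc; but on the unit circle it equals
  an off-diagonal entry of \<open>twist 1\<close>, which is \<open>z\<close> or \<open>- cnj z\<close>.
\<close>

lemma twist_not_product_of_four:
  assumes \<phi>: "continuous_map X euclidean \<phi>"
    and \<psi>: "continuous_map (top_of_set (cball 0 1)) X \<psi>"
    and \<phi>\<psi>: "\<And>z::complex. z \<in> cball 0 1 \<Longrightarrow> \<phi> (\<psi> z) = z"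
  shows "\<not> product_of_at_most 4 X (\<lambda>x. twist 1 (\<phi> x))"
proof
  assume "product_of_at_most 4 X (\<lambda>x. twist 1 (\<phi> x))"
  then obtain k p1 p2 p3 p4 where p: "continuous_map X euclidean p3"
    "\<And>x. x \<in> topspace X \<Longrightarrow> twist 1 (\<phi> x) = altprod k [p1 x, p2 x, p3 x, p4 x]"
    by (rule product_of_at_most_four_altprod) blast
  define q where "q = p3 \<circ> \<psi>"
  have q: "continuous_on (cball 0 1) q"
    using continuous_map_compose[OF \<psi> p(1)] by (simp add: q_def)
  have X: "\<psi> z \<in> topspace X" if "z \<in> cball 0 1" for z
    using continuous_map_funspace[OF \<psi>] that by auto
  have ent: "twist 1 z $ flip2 k $ flip2 k = 1 + p2 (\<psi> z) * q z"
    "twist 1 z $ k $ flip2 k = q z + p1 (\<psi> z) * twist 1 z $ flip2 k $ flip2 k"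
    if "z \<in> cball 0 1" for z
    using altprod_four_entries[OF p(2)[OF X[OF that]]]
      \<phi>\<psi>[OF that] by (auto simp: q_def)
  have sq: "(norm z)\<^sup>2 \<le> 1" if "z \<in> cball 0 1" for z :: complex
    using that power_le_one[of "norm z" 2] by simp
  \<comment> \<open>At \<open>t = 1\<close> the diagonal entries are \<open>twist_d 1 z\<close> and
    its conjugate divided by the positive \<open>twist_n 1 z\<close>; the \<open>min\<close> keeps
    their real parts nonpositive.\<close>
  have diag: "twist 1 z $ l $ l \<noteq> 1" if "z \<in> cball 0 1" for z l
  proof -
    have "Re (twist_d 1 z) \<le> 0" 
      by (simp add: twist_d_def)
    then have "Re (twist 1 z $ l $ l) \<le> 0"
      using twist_n_pos[of 1 z] exhaust_2[of l]
      by (auto simp: twist_def Re_divide_of_real divide_le_0_iff)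
    then show ?thesis by auto
  qed
  have nz: "q z \<noteq> 0" if "z \<in> cball 0 1" for z
    using ent(1)[OF that] diag[OF that] by auto
  \<comment> \<open>On the circle the diagonal vanishes, which removes the term with
    \<open>p1\<close>, and \<open>twist_n\<close> is 1, so the off-diagonal entries need no
    rescaling.\<close>
  have circ: "q z = (if k = 1 then z else - cnj z)" if "z \<in> sphere 0 1" for z
  proof -
    have "norm z = 1" using that by simp
    then have "twist_d 1 z = 0" "twist_n 1 z = 1" 
      by (auto simp: twist_n_def twist_d_def twist_b_def complex_eq_iff)
    then show ?thesis
      using ent(2)[of z] that exhaust_2[of k] by (auto simp: twist_def twist_b_def)
  qed
  \<comment> \<open>The map \<open>- cnj\<close> is its own inverse, so both values of
    \<open>k\<close> lead to the identity on the circle. Normalizing the nonvanishing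
    \<open>q\<close> then gives a retraction of the disc onto its boundary, which replaces the
    winding number argument.\<close>
  define r where "r z = (if k = 1 then q z else - cnj (q z)) /\<^sub>R norm (q z)" for z
  have "continuous_on (cball 0 1) r"
    unfolding r_def using nz by (cases "k = 1") (auto intro!: continuous_intros q)
  moreover have "r ` cball 0 1 \<subseteq> sphere 0 1"
    using nz by (auto simp: r_def)
  moreover have "r z = z" if "z \<in> sphere 0 1" for z
    using circ[OF that] that by (auto simp: r_def)
  ultimately have "retraction (cball 0 1) (sphere 0 1) r"
    by (auto simp: retraction_def)
  then show False
    using no_retraction_cball[of 1 "0::complex"] unfolding retract_of_def by (auto simp: frontier_cball)
qed

subsection \<open>The covering dimension of the cube\<close>

lemma covering_dim_less_homeomorphic_map:
  assumes f: "homeomorphic_map X Y f" and X: "covering_dim_less X k"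
  shows "covering_dim_less Y k"
  unfolding covering_dim_less_def
proof (intro allI impI)
  fix \<U> assume \<U>: "finite_open_cover Y \<U>"
  have fY: "f ` topspace X = topspace Y" and inj: "inj_on f (topspace X)" and cont: "continuous_map X Y f"
    using f by (simp_all add: homeomorphic_eq_everything_map)
  define \<U>' where "\<U>' = (\<lambda>U. {x \<in> topspace X. f x \<in> U}) ` \<U>"
  have "finite_open_cover X \<U>'"
    unfolding finite_open_cover_def
  proof (intro conjI ballI)
    show "finite \<U>'" using \<U> by (simp add: \<U>'_def finite_open_cover_def)
    show "openin X U" if "U \<in> \<U>'" for U
      using that \<U> openin_continuous_map_preimage[OF cont]
      by (auto simp: \<U>'_def finite_open_cover_def)
    have "f x \<in> \<Union>\<U>" if "x \<in> topspace X" for x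
      using that fY \<U> by (auto simp: finite_open_cover_def)
    then show "\<Union>\<U>' = topspace X"
      by (auto simp: \<U>'_def)
  qed
  then obtain \<V> where \<V>: "finite_open_cover X \<V>" "\<And>V. V \<in> \<V> \<Longrightarrow> \<exists>U\<in>\<U>'. V \<subseteq> U"
    "\<And>x. x \<in> topspace X \<Longrightarrow> card {V \<in> \<V>. x \<in> V} \<le> k"
    using X unfolding covering_dim_less_def by meson
  have sub: "V \<subseteq> topspace X" if "V \<in> \<V>" for V
    using \<V>(1) that by (auto simp: finite_open_cover_def)
  have "finite_open_cover Y ((`) f ` \<V>)"
    unfolding finite_open_cover_def
  proof (intro conjI ballI)
    show "finite ((`) f ` \<V>)" using \<V>(1) by (simp add: finite_open_cover_def)
  next
    fix V assume "V \<in> (`) f ` \<V>"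
    then obtain W where W: "W \<in> \<V>" "V = f ` W" by blast
    then show "openin Y V"
      using \<V>(1) homeomorphic_map_openness[OF f sub[OF W(1)]] by (simp add: finite_open_cover_def)
  next
    have "\<Union>\<V> = topspace X" using \<V>(1) by (simp add: finite_open_cover_def)
    then show "\<Union>((`) f ` \<V>) = topspace Y" using fY by (simp flip: image_Union)
  qed
  moreover have "\<exists>U\<in>\<U>. V \<subseteq> U" if V: "V \<in> (`) f ` \<V>" for V
  proof -
    obtain W where "W \<in> \<V>" "V = f ` W" using V by blast
    moreover from \<V>(2)[OF this(1)] obtain U where "U \<in> \<U>" "W \<subseteq> {x \<in> topspace X. f x \<in> U}"
      by (auto simp: \<U>'_def)
    ultimately show ?thesis by (intro bexI[of _ U]) auto
  qed
  moreover have "card {V \<in> (`) f ` \<V>. y \<in> V} \<le> k" if y: "y \<in> topspace Y" for y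
  proof -
    obtain x where x: "x \<in> topspace X" "y = f x" using y fY by blast
    \<comment> \<open>Injectivity matters here: the image of a member contains \<open>f x\<close>
      only if the member contains \<open>x\<close>, so multiplicities do not grow.\<close>
    have "{V \<in> (`) f ` \<V>. y \<in> V} \<subseteq> (`) f ` {V \<in> \<V>. x \<in> V}"
    proof
      fix V' assume "V' \<in> {V \<in> (`) f ` \<V>. y \<in> V}"
      then obtain V where V: "V \<in> \<V>" "V' = f ` V" "f x \<in> f ` V" using x(2) by auto
      have "x \<in> V" using inj_on_image_mem_iff[OF inj x(1) sub[OF V(1)]] V(3) by simp
      then show "V' \<in> (`) f ` {V \<in> \<V>. x \<in> V}" using V(1,2) by simp
    qed
    moreover have fin: "finite {V \<in> \<V>. x \<in> V}"
      using \<V>(1) by (simp add: finite_open_cover_def)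
    ultimately have "card {V \<in> (`) f ` \<V>. y \<in> V} \<le> card ((`) f ` {V \<in> \<V>. x \<in> V})"
      by (intro card_mono finite_imageI)
    also have "\<dots> \<le> card {V \<in> \<V>. x \<in> V}" by (rule card_image_le[OF fin])
    also have "\<dots> \<le> k" by (rule \<V>(3)[OF x(1)])
    finally show ?thesis .
  qed
  ultimately show "\<exists>\<V>. finite_open_cover Y \<V> \<and> (\<forall>V\<in>\<V>. \<exists>U\<in>\<U>. V \<subseteq> U) \<and>
      (\<forall>x\<in>topspace Y. card {V \<in> \<V>. x \<in> V} \<le> k)"
    by blast
qed

lemma has_covering_dim_homeomorphic_space:
  assumes "X homeomorphic_space Y" "has_covering_dim X d"
  shows "has_covering_dim Y d"
proof -
  obtain f g where "homeomorphic_map X Y f" "homeomorphic_map Y X g"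
    using assms(1) by (metis homeomorphic_space homeomorphic_space_sym)
  then show ?thesis
    using assms(2) covering_dim_less_homeomorphic_map[of X Y f]
      covering_dim_less_homeomorphic_map[of Y X g]
    unfolding has_covering_dim_def by blast
qed

section \<open>The cube in the space of real sequences\<close>

text \<open>Setting the remaining coordinates to 0 puts the cubes of all dimensions on one type,
  with the product topology.\<close>

definition cube :: "nat \<Rightarrow> (nat \<Rightarrow> real) set" where
  "cube n = {x. \<forall>i. if i < n then -1 \<le> x i \<and> x i \<le> 1 else x i = 0}"

lemma compact_cube: "compact (cube n)"
proof -
  have "cube n = PiE UNIV (\<lambda>i. if i < n then {-1..1} else {0})"
    unfolding cube_def PiE_UNIV_domain Pi_def by (intro Collect_cong) (simp add: Ball_def if_distrib)
  moreover have "compactin (product_topology (\<lambda>i::nat. euclidean) UNIV)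
      (PiE UNIV (\<lambda>i. if i < n then {-1..1::real} else {0}))"
    by (subst compactin_PiE) auto
  ultimately show ?thesis
    unfolding euclidean_product_topology compactin_euclidean_iff by simp
qed

lemma zero_in_cube: "(\<lambda>_. 0) \<in> cube n"
  by (simp add: cube_def)

text \<open>The metric on sequences gives late coordinates geometrically small weight. The lemma
  turns coordinatewise grid estimates into distances.\<close>

lemma dist_fun_uniform:
  fixes e :: real
  assumes "e > 0"
  obtains \<delta> where "\<delta> > 0"
    "\<And>x y :: nat \<Rightarrow> real. (\<And>i. \<bar>x i - y i\<bar> \<le> \<delta>) \<Longrightarrow> dist x y < e"
proof -
  obtain N where N: "(1/2 :: real) ^ N < e / 2"
    using real_arch_pow_inv[of "e/2" "1/2"] assms by auto
  show thesis
  \<comment> \<open>The distance is at most twice the maximum over the first coordinates plus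
    \<open>(1/2) ^ N\<close>, hence below \<open>e / 4 + e / 2\<close>.\<close>
  proof (rule that[of "e / 8"])
    fix x y :: "nat \<Rightarrow> real"
    assume *: "\<bar>x i - y i\<bar> \<le> e / 8" for i
    have "{dist (x (from_nat n)) (y (from_nat n))|n. n \<le> N} =
        (\<lambda>n. dist (x (from_nat n)) (y (from_nat n))) ` {..N}"
      by blast
    moreover have "Max ((\<lambda>n. dist (x (from_nat n)) (y (from_nat n))) ` {..N}) \<le> e / 8"
      using * by (intro Max.boundedI) (auto simp: dist_real_def)
    ultimately show "dist x y < e"
      using dist_fun_le_dist_first_terms[of x y N] N assms by simp
  qed (use assms in simp)
qed

section \<open>The Poincare-Miranda theorem\<close>

text \<open>The sum of the absolute values attains its minimum on the compact cube. Were the minimum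
  positive, Kuhn's combinatorial lemma on a fine grid would produce a point with a smaller
  sum.\<close>

lemma poincare_miranda_cube:
  fixes f :: "nat \<Rightarrow> (nat \<Rightarrow> real) \<Rightarrow> real"
  assumes cont: "\<And>i. i < n \<Longrightarrow> continuous_on (cube n) (f i)"
    and lo: "\<And>i x. \<lbrakk>i < n; x \<in> cube n; x i = -1\<rbrakk> \<Longrightarrow> f i x \<le> 0"
    and hi: "\<And>i x. \<lbrakk>i < n; x \<in> cube n; x i = 1\<rbrakk> \<Longrightarrow> f i x \<ge> 0"
  obtains x where "x \<in> cube n" "\<And>i. i < n \<Longrightarrow> f i x = 0"
proof -
  define S where "S x = (\<Sum>i<n. \<bar>f i x\<bar>)" for x
  have "continuous_on (cube n) S"
    unfolding S_def by (intro continuous_intros cont) auto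
  then obtain x0 where x0: "x0 \<in> cube n" "\<And>y. y \<in> cube n \<Longrightarrow> S x0 \<le> S y"
    using continuous_attains_inf[OF compact_cube, of n S] zero_in_cube by blast
  have "S x0 = 0"
  proof (rule ccontr)
    assume "S x0 \<noteq> 0"
    moreover have "S x0 \<ge> 0" unfolding S_def by (intro sum_nonneg) auto
    ultimately have pos: "S x0 > 0" by simp
    \<comment> \<open>Each \<open>\<bar>f i\<bar>\<close> will be at most \<open>2 * e\<close> at
      one grid point, so the sum there is at most \<open>2 * n / (2 * n + 2)\<close> times the
      minimum.\<close>
    define e where "e = S x0 / (2 * real n + 2)"
    have e: "e > 0" using pos by (simp add: e_def)
    have "\<exists>\<eta>>0. \<forall>x\<in>cube n. \<forall>y\<in>cube n. dist x y < \<eta> \<longrightarrow> \<bar>f i x - f i y\<bar> < e" if "i < n" for i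
      using compact_uniformly_continuous[OF cont[OF that] compact_cube] e
      unfolding uniformly_continuous_on_def dist_real_def by metis
    then obtain \<eta> where \<eta>: "\<And>i. i < n \<Longrightarrow> \<eta> i > 0"
      "\<And>i x y. \<lbrakk>i < n; x \<in> cube n; y \<in> cube n; dist x y < \<eta> i\<rbrakk> \<Longrightarrow> \<bar>f i x - f i y\<bar> < e"
      by metis
    define \<eta>0 where "\<eta>0 = Min (insert 1 (\<eta> ` {..<n}))"
    have \<eta>0: "\<eta>0 > 0" "\<And>i. i < n \<Longrightarrow> \<eta>0 \<le> \<eta> i"
      using \<eta>(1) by (auto simp: \<eta>0_def Min_gr_iff intro: Min_le)
    obtain \<delta> where \<delta>: "\<delta> > 0"
      "\<And>x y :: nat \<Rightarrow> real. (\<And>i. \<bar>x i - y i\<bar> \<le> \<delta>) \<Longrightarrow> dist x y < \<eta>0"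
      using dist_fun_uniform[OF \<eta>0(1)] by blast
    obtain p :: nat where p: "p > 0" "2 / real p \<le> \<delta>"
    proof -
      obtain p :: nat where "p > 0" "inverse (real p) < \<delta> / 2"
        using ex_inverse_of_nat_less[of "\<delta>/2"] \<delta>(1) by auto
      then show thesis by (intro that[of p]) (auto simp: field_simps)
    qed
    define pt where "pt q = (\<lambda>i. if i < n then 2 * real (q i) / real p - 1 else 0)" for q :: "nat \<Rightarrow> nat"
    have pt: "pt q \<in> cube n" if "\<forall>i<n. q i \<le> p" for q
      using that p(1) by (auto simp: cube_def pt_def field_simps)
    \<comment> \<open>Labels record the sign of \<open>f i\<close>, except that Kuhn's lemma
      prescribes them on the faces; by \<open>lo\<close> and \<open>hi\<close> the prescribed values
      still agree with the weak signs.\<close>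
    define label where "label q i =
      (if q i = 0 then 0 else if q i = p then 1 else if f i (pt q) \<ge> 0 then 1 else 0 :: nat)" for q i
    have lab: "\<forall>q. (\<forall>i<n. q i \<le> p) \<longrightarrow> (\<forall>i<n. label q i = 0 \<or> label q i = 1)"
      "\<forall>q. (\<forall>i<n. q i \<le> p) \<longrightarrow> (\<forall>i<n. q i = 0 \<longrightarrow> label q i = 0)"
      "\<forall>q. (\<forall>i<n. q i \<le> p) \<longrightarrow> (\<forall>i<n. q i = p \<longrightarrow> label q i = 1)"
      using p(1) by (auto simp: label_def)
    have lab0: "f i (pt q) \<le> 0" if "\<forall>i<n. q i \<le> p" "i < n" "label q i = 0" for q i
      using that lo[OF that(2) pt[OF that(1)]] by (auto simp: label_def pt_def split: if_splits)
    have lab1: "f i (pt q) \<ge> 0" if "\<forall>i<n. q i \<le> p" "i < n" "label q i = 1" for q i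
      using that hi[OF that(2) pt[OF that(1)]] p(1) by (auto simp: label_def pt_def split: if_splits)
    obtain q where q: "\<forall>i<n. q i < p"
      "\<forall>i<n. \<exists>r s. (\<forall>j<n. q j \<le> r j \<and> r j \<le> q j + 1) \<and> (\<forall>j<n. q j \<le> s j \<and> s j \<le> q j + 1) \<and>
         label r i \<noteq> label s i"
      using kuhn_lemma[OF p(1) lab] by blast
    have le_p: "\<forall>j<n. r j \<le> p" if "\<forall>j<n. q j \<le> r j \<and> r j \<le> q j + 1" for r
    proof (intro allI impI)
      fix j assume "j < n"
      then have "q j < p" "r j \<le> q j + 1" using q(1) that by auto
      then show "r j \<le> p" by simp
    qed
    have near: "\<bar>f i (pt r) - f i (pt s)\<bar> < e"
      if "i < n" "\<forall>j<n. q j \<le> r j \<and> r j \<le> q j + 1" "\<forall>j<n. q j \<le> s j \<and> s j \<le> q j + 1" for i r s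
    proof -
      have "\<bar>pt r j - pt s j\<bar> \<le> \<delta>" for j
      proof (cases "j < n")
        case True
        then have "pt r j - pt s j = 2 / real p * (real (r j) - real (s j))"
          using p(1) by (simp add: pt_def field_simps)
        moreover have "\<bar>real (r j) - real (s j)\<bar> \<le> 1"
          using that(2,3) True by (smt (verit) of_nat_1 of_nat_add of_nat_mono)
        ultimately have "\<bar>pt r j - pt s j\<bar> \<le> 2 / real p * 1"
          by (simp only: abs_mult) (intro mult_mono; simp)
        then show ?thesis using p(2) by simp
      qed (use \<delta>(1) in \<open>simp add: pt_def\<close>)
      then have "dist (pt r) (pt s) < \<eta> i"
        using \<delta>(2)[of "pt r" "pt s"] \<eta>0(2)[OF that(1)] by (meson less_le_trans)
      moreover have "\<forall>j<n. r j \<le> p" "\<forall>j<n. s j \<le> p"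
        using le_p that(2,3) by blast+
      ultimately show ?thesis
        using \<eta>(2)[OF that(1)] pt by blast
    qed
    \<comment> \<open>Kuhn's cell has two corners where \<open>f i\<close> has opposite weak signs.
      Their values differ by less than \<open>e\<close>, so both are below \<open>e\<close> in
      absolute value, and the corner \<open>q\<close> adds at most another \<open>e\<close>.\<close>
    have small: "\<bar>f i (pt q)\<bar> \<le> 2 * e" if i: "i < n" for i
    proof -
      obtain r s where rs: "\<forall>j<n. q j \<le> r j \<and> r j \<le> q j + 1" "\<forall>j<n. q j \<le> s j \<and> s j \<le> q j + 1"
        "label r i \<noteq> label s i"
        using q(2) i by blast
      have le: "\<forall>j<n. r j \<le> p" "\<forall>j<n. s j \<le> p"
        using le_p rs(1,2) by blast+
      have "label r i = 0 \<and> label s i = 1 \<or> label r i = 1 \<and> label s i = 0"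
        using lab(1) le i rs(3) by metis
      then have "f i (pt r) \<le> 0 \<and> f i (pt s) \<ge> 0 \<or> f i (pt r) \<ge> 0 \<and> f i (pt s) \<le> 0"
        using lab0 lab1 le i by metis
      moreover have "\<bar>f i (pt q) - f i (pt r)\<bar> < e" "\<bar>f i (pt r) - f i (pt s)\<bar> < e"
        using rs by (auto intro!: near i)
      ultimately show ?thesis by linarith
    qed
    have "S (pt q) \<le> (\<Sum>i<n. 2 * e)"
      unfolding S_def by (intro sum_mono small) auto
    also have "\<dots> = S x0 * (2 * real n / (2 * real n + 2))"
      by (simp add: e_def)
    also have "\<dots> < S x0"
      using pos by (simp add: divide_simps)
    finally show False
      using x0(2)[OF pt[of q]] q(1) by (simp add: less_imp_le)
  qed
  then have "f i x0 = 0" if "i < n" for i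
    using that sum_nonneg_eq_0_iff[of "{..<n}" "\<lambda>i. \<bar>f i x0\<bar>"] by (simp add: S_def)
  then show thesis by (rule that[OF x0(1)])
qed

section \<open>Lower bound for the dimension of the cube\<close>

text \<open>
  The cover consists of the sets \<open>x i < 1\<close> for \<open>i < n\<close> and the set where all coordinates exceed
  \<open>- 1\<close>.  Grouping a refinement by these gives \<open>W 0, \<dots>, W n\<close> with positivity functions \<open>g i\<close>, and
  the differences \<open>g n - g i\<close> have the signs needed for a common zero, which lies in every \<open>W i\<close>.
\<close>

lemma not_covering_dim_less_cube: "\<not> covering_dim_less (top_of_set (cube n)) n"
proof
  assume cd: "covering_dim_less (top_of_set (cube n)) n"
  let ?T = "cube n"
  define U where "U i = ?T \<inter> (if i < n then {x. x i < 1} else {x. \<forall>j<n. -1 < x j})" for i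
  have "open {x :: nat \<Rightarrow> real. \<forall>j<n. -1 < x j}"
  proof -
    have "{x :: nat \<Rightarrow> real. \<forall>j<n. -1 < x j} = (\<Inter>j\<in>{..<n}. {x. -1 < x j})" by auto
    also have "open \<dots>" by (intro open_INT ballI open_Collect_less continuous_intros) auto
    finally show ?thesis .
  qed
  moreover have "open {x :: nat \<Rightarrow> real. x i < 1}" for i
    by (intro open_Collect_less continuous_intros) auto
  ultimately have "openin (top_of_set ?T) (U i)" for i
    unfolding U_def by (cases "i < n") (simp_all add: openin_open_Int)
  moreover have "(\<Union>i\<le>n. U i) = ?T"
  proof
    show "?T \<subseteq> (\<Union>i\<le>n. U i)"
    proof
      fix x assume x: "x \<in> ?T"
      show "x \<in> (\<Union>i\<le>n. U i)"
      proof (cases "\<exists>i<n. x i < 1")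
        case True
        then show ?thesis using x by (auto simp: U_def intro: less_imp_le)
      next
        case False
        then have "x \<in> U n" using x by (force simp: U_def)
        then show ?thesis by blast
      qed
    qed
  qed (auto simp: U_def split: if_splits)
  ultimately have cover: "finite_open_cover (top_of_set ?T) (U ` {..n})"
    by (auto simp: finite_open_cover_def)
  from cd[unfolded covering_dim_less_def, rule_format, OF cover]
  obtain \<V> where *: "finite_open_cover (top_of_set ?T) \<V> \<and>
      (\<forall>V\<in>\<V>. \<exists>U'\<in>U ` {..n}. V \<subseteq> U') \<and>
      (\<forall>x\<in>topspace (top_of_set ?T). card {V \<in> \<V>. x \<in> V} \<le> n)"
    by (rule exE)
  then have \<V>: "finite_open_cover (top_of_set ?T) \<V>"
    "\<And>V. V \<in> \<V> \<Longrightarrow> \<exists>i\<le>n. V \<subseteq> U i" "\<And>x. x \<in> ?T \<Longrightarrow> card {V \<in> \<V>. x \<in> V} \<le> n"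
    by (simp_all add: Bex_def)
  obtain c where c: "\<And>V. V \<in> \<V> \<Longrightarrow> c V \<le> n \<and> V \<subseteq> U (c V)"
    using \<V>(2) by metis
  define W where "W i = \<Union>{V \<in> \<V>. c V = i}" for i
  have W: "openin (top_of_set ?T) (W i)" "W i \<subseteq> U i" for i
    using \<V>(1) c unfolding W_def finite_open_cover_def by blast+
  \<comment> \<open>The extra point keeps the set nonempty: \<open>infdist x {} = 0\<close>.\<close>
  define C where "C i = insert (\<lambda>_. 2) (?T - W i)" for i
  define g where "g i x = infdist x (C i)" for i and x :: "nat \<Rightarrow> real"
  have "closed (C i)" for i
    unfolding C_def using W(1)[of i] compact_imp_closed[OF compact_cube, of n]
    by (intro closed_insert) (metis closedin_closed_trans closedin_diff closedin_topspace topspace_euclidean_subtopology)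
  \<comment> \<open>As the added point lies outside the cube, it does not affect the zeros of
    \<open>g i\<close> on the cube.\<close>
  moreover have "(\<lambda>_. 2) \<notin> ?T"
    by (auto simp: cube_def dest: spec[of _ 0])
  ultimately have g0: "g i x = 0 \<longleftrightarrow> x \<notin> W i" if "x \<in> ?T" for i x
    using that in_closed_iff_infdist_zero[of "C i" x] by (auto simp: g_def C_def)
  have gge: "g i x \<ge> 0" for i x by (simp add: g_def infdist_nonneg)
  obtain x where x: "x \<in> ?T" "\<And>i. i < n \<Longrightarrow> g n x - g i x = 0"
  proof (rule poincare_miranda_cube[of n "\<lambda>i x. g n x - g i x"])
    show "continuous_on ?T (\<lambda>x. g n x - g i x)" for i
      unfolding g_def by (intro continuous_intros)
    \<comment> \<open>On the face \<open>x i = -1\<close> the point leaves \<open>U n\<close>, so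
      \<open>g n\<close> vanishes; on the opposite face it leaves \<open>U i\<close>, so
      \<open>g i\<close> vanishes.\<close>
    show "g n x - g i x \<le> 0" if "i < n" "x \<in> ?T" "x i = -1" for i x
    proof -
      have "x \<notin> U n" using that by (auto simp: U_def)
      then show ?thesis using g0[OF that(2), of n] W(2) gge[of i x] by auto
    qed
    show "g n x - g i x \<ge> 0" if "i < n" "x \<in> ?T" "x i = 1" for i x
    proof -
      have "x \<notin> U i" using that by (auto simp: U_def)
      then show ?thesis using g0[OF that(2), of i] W(2) gge[of n x] by auto
    qed
  qed blast
  have eq: "g i x = g n x" if "i \<le> n" for i
    using x(2)[of i] that by (cases "i = n") auto
  \<comment> \<open>Some member contains \<open>x\<close>, so one of the equal values
    \<open>g i x\<close> is positive, and hence all are. The members containing \<open>x\<close>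
    then map onto all \<open>n + 1\<close> indices under \<open>c\<close>.\<close>
  obtain V where "V \<in> \<V>" "x \<in> V"
    using x(1) \<V>(1) by (auto simp: finite_open_cover_def)
  then have "x \<in> W (c V)" "c V \<le> n" using c by (auto simp: W_def)
  then have "x \<in> W i" if "i \<le> n" for i
    using eq[of "c V"] eq[OF that] g0[OF x(1)] by metis
  then have "{..n} \<subseteq> c ` {V \<in> \<V>. x \<in> V}"
    unfolding W_def by blast
  moreover have fin: "finite {V \<in> \<V>. x \<in> V}"
    using \<V>(1) by (simp add: finite_open_cover_def)
  ultimately have "Suc n \<le> card {V \<in> \<V>. x \<in> V}"
    using surj_card_le[OF fin] by fastforce
  then show False using \<V>(3)[OF x(1)] by simp
qed

section \<open>Upper bound for the dimension of the cube\<close>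

text \<open>
  The refinement consists of grid boxes of \<open>n + 1\<close> grids, shifted diagonally by multiples of
  \<open>1 / (n + 1)\<close>.  Each coordinate of a point lies on a wall of at most one of the grids,
  so some grid has the point in an open box; and in each grid only one box contains it.
\<close>

lemma covering_dim_less_cube: "covering_dim_less (top_of_set (cube n)) (Suc n)"
  unfolding covering_dim_less_def
proof (intro allI impI)
  fix \<U> assume \<U>: "finite_open_cover (top_of_set (cube n)) \<U>"
  let ?T = "cube n"
  define \<G> where "\<G> = {G. open G \<and> ?T \<inter> G \<in> \<U>}"
  have cov: "?T \<subseteq> \<Union>\<G>"
  proof
    fix x assume "x \<in> ?T"
    moreover have "\<Union>\<U> = ?T" using \<U> by (simp add: finite_open_cover_def)
    ultimately obtain U where "U \<in> \<U>" "x \<in> U" by blast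
    moreover from this \<U> have "openin (top_of_set ?T) U" by (simp add: finite_open_cover_def)
    then obtain G where "open G" "U = ?T \<inter> G" unfolding openin_open by blast
    ultimately have "G \<in> \<G>" "x \<in> G" by (simp_all add: \<G>_def)
    then show "x \<in> \<Union>\<G>" by blast
  qed
  have "open G" if "G \<in> \<G>" for G using that by (simp add: \<G>_def)
  \<comment> \<open>\<open>e\<close> is a Lebesgue number of the cover; boxes of side
    \<open>1 / M\<close> will be small enough to fit into such balls.\<close>
  from Heine_Borel_lemma[OF compact_cube cov this]
  obtain e where e: "e > 0" "\<And>x. x \<in> ?T \<Longrightarrow> \<exists>G\<in>\<G>. ball x e \<subseteq> G"
    by metis
  obtain \<delta> where \<delta>: "\<delta> > 0"
    "\<And>x y :: nat \<Rightarrow> real. (\<And>i. \<bar>x i - y i\<bar> \<le> \<delta>) \<Longrightarrow> dist x y < e"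
    using dist_fun_uniform[OF e(1)] by blast
  obtain M :: nat where M: "M > 0" "inverse (real M) < \<delta>"
    using ex_inverse_of_nat_less[OF \<delta>(1)] by auto
  \<comment> \<open>This rescaling puts the walls of the \<open>k\<close>-th grid at the
    integers.\<close>
  define h where "h k t = real M * t - real k / real (Suc n)" for k t
  define A where "A k m = {x \<in> ?T. \<forall>i<n. of_int (m i) < h k (x i) \<and> h k (x i) < of_int (m i) + 1}"
    for k and m :: "nat \<Rightarrow> int"
  \<comment> \<open>The range contains every floor of \<open>h k\<close> on \<open>[-1, 1]\<close>,
    since the shift lies in \<open>[0, 1]\<close>. Extensionality outside \<open>{..<n}\<close>
    makes the index set finite; \<open>cell\<close> is restricted to match.\<close>
  define P where "P = PiE {..<n} (\<lambda>_. {- int M - 1..int M})"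
  define \<V> where "\<V> = (\<lambda>(k, m). A k m) ` ({..n} \<times> P)"
  define cell where "cell k x = restrict (\<lambda>i. \<lfloor>h k (x i)\<rfloor>) {..<n}" for k and x :: "nat \<Rightarrow> real"
  have fin: "finite \<V>"
    unfolding \<V>_def P_def by (intro finite_imageI finite_cartesian_product finite_PiE) auto
  have "openin (top_of_set ?T) (A k m)" for k m
  proof -
    have "A k m = ?T \<inter> (\<Inter>i\<in>{..<n}. {x. of_int (m i) < h k (x i)} \<inter> {x. h k (x i) < of_int (m i) + 1})"
      by (auto simp: A_def)
    moreover have "open (\<Inter>i\<in>{..<n}. {x::nat\<Rightarrow>real. of_int (m i) < h k (x i)} \<inter> {x. h k (x i) < of_int (m i) + 1})"
      unfolding h_def by (intro open_INT ballI open_Int open_Collect_less continuous_intros) auto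
    ultimately show ?thesis by (simp only: openin_open_Int)
  qed
  moreover have "\<Union>\<V> = ?T"
  proof
    show "?T \<subseteq> \<Union>\<V>"
    proof
      fix x assume x: "x \<in> ?T"
      \<comment> \<open>Otherwise two of the \<open>n + 1\<close> grids have a wall through the same
        coordinate, and their shifts differ by an integer strictly between 0 and 1.\<close>
      have "\<exists>k\<le>n. \<forall>i<n. h k (x i) \<notin> \<int>"
      proof (rule ccontr)
        assume "\<not> ?thesis"
        then obtain \<iota> where \<iota>: "\<And>k. k \<le> n \<Longrightarrow> \<iota> k < n \<and> h k (x (\<iota> k)) \<in> \<int>" by metis
        have "\<iota> ` {..n} \<subseteq> {..<n}" using \<iota> by auto
        then have "card (\<iota> ` {..n}) < card {..n}"
          using card_mono[of "{..<n}" "\<iota> ` {..n}"] by simp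
        then have "\<not> inj_on \<iota> {..n}" by (rule pigeonhole)
        then obtain k l where kl: "k \<le> n" "l \<le> n" "k < l" "\<iota> k = \<iota> l"
          unfolding inj_on_def by (metis atMost_iff linorder_neqE_nat)
        have "h k (x (\<iota> k)) - h l (x (\<iota> l)) \<in> \<int>"
          using \<iota> kl(1,2) by (intro Ints_diff) auto
        moreover have "h k (x (\<iota> k)) - h l (x (\<iota> l)) = (real l - real k) / real (Suc n)"
          using kl(4) by (simp add: h_def diff_divide_distrib)
        ultimately obtain z :: int where z: "(real l - real k) / real (Suc n) = of_int z"
          by (auto elim: Ints_cases)
        have "0 < (real l - real k) / real (Suc n)" "(real l - real k) / real (Suc n) < 1"
          using kl by (auto simp: divide_simps)
        then show False unfolding z by simp
      qed
      then obtain k where k: "k \<le> n" "\<And>i. i < n \<Longrightarrow> h k (x i) \<notin> \<int>" by blast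
      have "of_int \<lfloor>h k (x i)\<rfloor> < h k (x i)" if "i < n" for i
        using k(2)[OF that] by (metis Ints_of_int floor_correct order_le_less)
      then have "x \<in> A k (cell k x)"
        using x by (auto simp: A_def cell_def)
      moreover have "cell k x \<in> P"
        unfolding P_def cell_def
      proof (intro restrict_PiE_iff[THEN iffD2] ballI)
        fix i assume "i \<in> {..<n}"
        then have "-1 \<le> x i" "x i \<le> 1" using x by (auto simp: cube_def dest: spec[of _ i])
        then have "\<bar>real M * x i\<bar> \<le> real M * 1"
          unfolding abs_mult by (intro mult_mono) auto
        moreover have "0 \<le> real k / real (Suc n)" "real k / real (Suc n) \<le> 1"
          using k(1) by (auto simp: divide_simps)
        ultimately have "- real M - 1 \<le> h k (x i)" "h k (x i) \<le> real M"
          unfolding h_def by linarith+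
        then show "\<lfloor>h k (x i)\<rfloor> \<in> {- int M - 1..int M}"
          by (auto simp: le_floor_iff floor_le_iff)
      qed
      ultimately show "x \<in> \<Union>\<V>" using k(1) by (auto simp: \<V>_def)
    qed
  qed (auto simp: \<V>_def A_def)
  ultimately have "finite_open_cover (top_of_set ?T) \<V>"
    using fin by (auto simp: finite_open_cover_def \<V>_def)
  moreover have "\<exists>U\<in>\<U>. A k m \<subseteq> U" for k m
  proof (cases "A k m = {}")
    case True
    have "\<Union>\<U> = ?T" using \<U> by (simp add: finite_open_cover_def)
    then have "\<U> \<noteq> {}" using zero_in_cube[of n] by blast
    then show ?thesis using True by blast
  next
    case False
    then obtain x where x: "x \<in> A k m" by blast
    then have "x \<in> ?T" by (simp add: A_def)
    then obtain G where G: "G \<in> \<G>" "ball x e \<subseteq> G" using e(2) by blast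
    have "A k m \<subseteq> ?T \<inter> G"
    proof
      fix y assume y: "y \<in> A k m"
      have "\<bar>x i - y i\<bar> \<le> \<delta>" for i
      proof (cases "i < n")
        case True
        then have "\<bar>h k (x i) - h k (y i)\<bar> < 1"
          using x y unfolding A_def by fastforce
        then have "real M * \<bar>x i - y i\<bar> < 1"
          by (simp add: h_def abs_mult flip: right_diff_distrib)
        then have "\<bar>x i - y i\<bar> < inverse (real M)"
          using M(1) by (simp add: field_simps)
        then show ?thesis using M(2) by linarith
      next
        case False
        then show ?thesis using x y \<delta>(1) by (auto simp: A_def cube_def dest!: spec[of _ i])
      qed
      then have "y \<in> ball x e" using \<delta>(2) by simp
      then show "y \<in> ?T \<inter> G" using G(2) y by (auto simp: A_def)
    qed
    moreover have "?T \<inter> G \<in> \<U>" using G(1) by (simp add: \<G>_def)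
    ultimately show ?thesis by (rule bexI)
  qed
  then have "\<forall>V\<in>\<V>. \<exists>U\<in>\<U>. V \<subseteq> U" by (auto simp: \<V>_def)
  moreover have "card {V \<in> \<V>. x \<in> V} \<le> Suc n" for x
  proof -
    have m: "m = cell k x" if "m \<in> P" "x \<in> A k m" for k m
    proof
      fix i
      show "m i = cell k x i"
      proof (cases "i < n")
        case True
        then have "of_int (m i) < h k (x i)" "h k (x i) < of_int (m i) + 1"
          using that(2) by (auto simp: A_def)
        then have "\<lfloor>h k (x i)\<rfloor> = m i" by linarith
        then show ?thesis using True by (simp add: cell_def)
      next
        case False
        then have "m i = undefined"
          using that(1) PiE_arb[of m "{..<n}" _ i] by (simp add: P_def)
        then show ?thesis using False by (simp add: cell_def)
      qed
    qed
    have "{V \<in> \<V>. x \<in> V} \<subseteq> (\<lambda>k. A k (cell k x)) ` {..n}"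
    proof
      fix V assume "V \<in> {V \<in> \<V>. x \<in> V}"
      then obtain k l where V: "k \<le> n" "l \<in> P" "V = A k l" "x \<in> A k l"
        unfolding \<V>_def by auto
      show "V \<in> (\<lambda>k. A k (cell k x)) ` {..n}"
        using V(1,3) m[OF V(2,4)] by simp
    qed
    then have "card {V \<in> \<V>. x \<in> V} \<le> card {..n}"
      by (meson card_image_le card_mono finite_atMost finite_imageI le_trans)
    then show ?thesis by simp
  qed
  ultimately show "\<exists>\<V>. finite_open_cover (top_of_set ?T) \<V> \<and> (\<forall>V\<in>\<V>. \<exists>U\<in>\<U>. V \<subseteq> U) \<and>
      (\<forall>x\<in>topspace (top_of_set ?T). card {V \<in> \<V>. x \<in> V} \<le> Suc n)"
    by blast
qed

lemma has_covering_dim_cube: "has_covering_dim (top_of_set (cube n)) n"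
  by (simp add: has_covering_dim_def covering_dim_less_cube not_covering_dim_less_cube)

subsection \<open>The cube as a space on a type of at least continuum size\<close>

text \<open>Reals are coded as sets of naturals, and a sequence of such sets becomes a single one
  through \<open>prod_encode\<close>.\<close>

lemma real_sequences_lepoll_reals: "(UNIV :: (nat \<Rightarrow> real) set) \<lesssim> (UNIV :: real set)"
proof -
  obtain s :: "real \<Rightarrow> nat set" where s: "inj s"
    using eqpoll_imp_lepoll[OF eqpoll_sym[OF nat_sets_eqpoll_reals]] by (auto simp: lepoll_def)
  have "inj (\<lambda>x :: nat \<Rightarrow> real. {prod_encode (i, k) |i k. k \<in> s (x i)})"
  proof (rule injI, rule ext)
    fix x y :: "nat \<Rightarrow> real" and i
    assume "{prod_encode (i, k) |i k. k \<in> s (x i)} = {prod_encode (i, k) |i k. k \<in> s (y i)}"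
    then have "k \<in> s (x i) \<longleftrightarrow> k \<in> s (y i)" for k
      by (auto simp: set_eq_iff dest!: spec[of _ "prod_encode (i, k)"])
    then show "x i = y i" using s by (auto dest: injD)
  qed
  then have "(UNIV :: (nat \<Rightarrow> real) set) \<lesssim> (UNIV :: nat set set)"
    by (auto simp: lepoll_def)
  then show ?thesis
    using lepoll_trans eqpoll_imp_lepoll[OF nat_sets_eqpoll_reals] by blast
qed

lemma product_of_at_most_mono:
  "product_of_at_most K X f \<Longrightarrow> K \<le> L \<Longrightarrow> product_of_at_most L X f"
  unfolding product_of_at_most_def by (meson le_trans)

lemma continuous_map_coordinate:
  "continuous_map (top_of_set S) euclidean (\<lambda>x. Complex (x (0::nat)) (x 1))"
  unfolding Complex_eq continuous_map_iff_continuous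
  by (intro continuous_intros continuous_on_product_coordinates[THEN continuous_on_subset]) auto

lemma exists_space_not_product_of_four:
  assumes "(UNIV :: real set) \<lesssim> (UNIV :: 'a set)" and "d \<ge> 2"
  obtains X :: "'a topology" and f :: "'a \<Rightarrow> 2 cmat"
  where "normal_space X" "has_covering_dim X d" "nullhomotopic_SL X f"
    "\<not> product_of_at_most 4 X f"
proof -
  let ?T = "top_of_set (cube d)"
  obtain j :: "(nat \<Rightarrow> real) \<Rightarrow> 'a" where j: "inj j"
    using lepoll_trans[OF real_sequences_lepoll_reals assms(1)] by (auto simp: lepoll_def)
  \<comment> \<open>Pulling back along \<open>inv j\<close> copies the cube onto the image of
    \<open>j\<close> in \<open>'a\<close>, with \<open>j\<close> as a homeomorphism.\<close>
  define X where "X = pullback_topology (j ` cube d) (inv j) ?T"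
  have X: "topspace X = j ` cube d"
    using j by (auto simp: X_def topspace_pullback_topology)
  have inv: "continuous_map X ?T (inv j)"
    using continuous_map_pullback[OF continuous_map_id, of "j ` cube d" "inv j" ?T] by (simp add: X_def)
  have map: "continuous_map ?T X j"
    unfolding X_def using j by (intro continuous_map_pullback') (auto simp: o_def)
  have hom: "?T homeomorphic_space X"
    unfolding homeomorphic_space_def homeomorphic_maps_def
    using map inv j X by (intro exI[of _ j] exI[of _ "inv j"]) auto
  have "metrizable_space ?T"
    by (simp add: metrizable_space_euclidean metrizable_space_subtopology)
  then have normal: "normal_space X"
    using hom homeomorphic_normal_space metrizable_imp_normal_space by blast
  have dim: "has_covering_dim X d"
    by (rule has_covering_dim_homeomorphic_space[OF hom has_covering_dim_cube])
  define \<phi> where "\<phi> x = Complex (inv j x 0) (inv j x 1)" for x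
  have \<phi>: "continuous_map X euclidean \<phi>"
    using continuous_map_compose[OF inv continuous_map_coordinate] by (simp add: \<phi>_def[abs_def] o_def)
  have null: "nullhomotopic_SL X (\<lambda>x. twist 1 (\<phi> x))"
    by (rule nullhomotopic_twist[OF \<phi>])
  \<comment> \<open>The disc is placed in the first two coordinates, which exist because
    \<open>d \<ge> 2\<close>; \<open>\<phi>\<close> reads them off again.\<close>
  define e where "e z i = (if i = 0 then Re z else if i = 1 then Im z else 0)" for z and i :: nat
  have "continuous_on (cball 0 1) e"
    unfolding e_def
  proof (intro continuous_on_coordinatewise_then_product)
    show "continuous_on (cball 0 1) (\<lambda>z. if i = 0 then Re z else if i = 1 then Im z else 0)" for i :: nat
      by (cases "i = 0"; cases "i = 1") (auto intro!: continuous_intros)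
  qed
  moreover have "e z \<in> cube d" if "z \<in> cball 0 1" for z
  proof -
    have "\<bar>Re z\<bar> \<le> 1" "\<bar>Im z\<bar> \<le> 1"
      using that abs_Re_le_cmod[of z] abs_Im_le_cmod[of z] by auto
    then show ?thesis using assms(2) by (auto simp: cube_def e_def)
  qed
  ultimately have "continuous_map (top_of_set (cball 0 1)) ?T e"
    by (auto simp: continuous_map_in_subtopology)
  then have \<psi>: "continuous_map (top_of_set (cball 0 1)) X (j \<circ> e)"
    using map by (rule continuous_map_compose)
  have "\<not> product_of_at_most 4 X (\<lambda>x. twist 1 (\<phi> x))"
    by (rule twist_not_product_of_four[OF \<phi> \<psi>]) (use j in \<open>simp add: \<phi>_def e_def\<close>)
  then show thesis by (rule that[OF normal dim null])
qed

theorem lemma5p3: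
  fixes d :: nat
  assumes "(UNIV :: real set) \<lesssim> (UNIV :: 'a set)" and "d \<ge> 2"
  shows "unitri_number TYPE('a) TYPE(2) d \<ge> 5"
proof -
  obtain X :: "'a topology" and f :: "'a \<Rightarrow> 2 cmat" where X: "normal_space X" "has_covering_dim X d"
    "nullhomotopic_SL X f" "\<not> product_of_at_most 4 X f"
    using exists_space_not_product_of_four[OF assms] .
  \<comment> \<open>The infimum is bounded below by excluding each \<open>L \<le> 4\<close>; one
    counterexample to four factors excludes all of them.\<close>
  have "5 \<le> L" if "suffices TYPE('a) TYPE(2) d L" for L
  proof (rule ccontr)
    assume "\<not> 5 \<le> L"
    then have "L \<le> 4" by simp
    moreover have "product_of_at_most L X f"
      using that[unfolded suffices_def, rule_format, OF X(1-3)] .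
    ultimately show False using product_of_at_most_mono X(4) by blast
  qed
  then show ?thesis
    unfolding unitri_number_def by (auto intro!: Inf_greatest simp: numeral_eq_enat)
qed

end
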